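(* Let $\mathcal{L}$ be a $4$-dimensional solvable Leibniz algebra over $\mathbb{C}$ whose nilradical is isomorphic to the $3$-dimensional algebra $\lambda_5:\ [e_2,e_1]=e_3,\ [e_1,e_2]=e_3$. Then $\mathcal{L}$ is isomorphic to the following algebra with basis $\{x,e_1,e_2,e_3\}$: $$\mathcal{L}_{44}:\ [e_1,e_2]=e_3,\ [e_2,e_1]=e_3,\ [e_1,x]=e_1,\ [e_2,x]=e_2,\ [e_3,x]=2e_3,\ [x,e_1]=-e_1,\ [x,e_2]=-e_2.$$
   Context: A (right) Leibniz algebra over $\mathbb{C}$ is a $\mathbb{C}$-vector space $\mathcal{L}$ with a bilinear bracket $[-,-]:\mathcal{L}\times\mathcal{L}\to\mathcal{L}$ satisfying $[x,[y,z]]=[[x,y],z]-[[x,z],y]$ for all $x,y,z\in\mathcal{L}$. All algebras are finite-dimensional over $\mathbb{C}$. Define $\mathcal{L}^1=\mathcal{L}$, $\mathcal{L}^{k+1}=[\mathcal{L}^k,\mathcal{L}]$ and $\mathcal{L}^{[1]}=\mathcal{L}$, $\mathcal{L}^{[s+1]}=[\mathcal{L}^{[s]},\mathcal{L}^{[s]}]$; $\mathcal{L}$ is nilpotent (resp. solvable) if $\mathcal{L}^n=0$ for some $n$ (resp. $\mathcal{L}^{[m]}=0$ for some $m$). The nilradical of $\mathcal{L}$ is its maximal nilpotent (two-sided) ideal. In multiplication tables, products of basis elements that are not listed are zero. *)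

theory Defs
  imports "HOL-Analysis.Analysis"
begin

locale leibniz_algebra = vector_space scale
  for scale :: "complex \<Rightarrow> 'a::ab_group_add \<Rightarrow> 'a" (infixr \<open>*\<^sub>C\<close> 75) +
  fixes bracket :: "'a \<Rightarrow> 'a \<Rightarrow> 'a" (\<open>\<lbrakk>_, _\<rbrakk>\<close>)
  assumes linear_left: "Vector_Spaces.linear scale scale (\<lambda>x. \<lbrakk>x, y\<rbrakk>)"
    and linear_right: "Vector_Spaces.linear scale scale (\<lambda>y. \<lbrakk>x, y\<rbrakk>)"
    and leibniz: "\<lbrakk>x, \<lbrakk>y, z\<rbrakk>\<rbrakk> = \<lbrakk>\<lbrakk>x, y\<rbrakk>, z\<rbrakk> - \<lbrakk>\<lbrakk>x, z\<rbrakk>, y\<rbrakk>"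
begin

definition product_space :: "'a set \<Rightarrow> 'a set \<Rightarrow> 'a set"
  where "product_space A B = span {\<lbrakk>a, b\<rbrakk> | a b. a \<in> A \<and> b \<in> B}"

text \<open>Indices are shifted by one: \<open>lower_central_series A k\<close> is the term $A^{k+1}$,
  and \<open>derived_series A k\<close> is the term $A^{[k+1]}$.\<close>

primrec lower_central_series :: "'a set \<Rightarrow> nat \<Rightarrow> 'a set"
  where
    "lower_central_series A 0 = A"
  | "lower_central_series A (Suc k) = product_space (lower_central_series A k) A"

primrec derived_series :: "'a set \<Rightarrow> nat \<Rightarrow> 'a set"
  where
    "derived_series A 0 = A"
  | "derived_series A (Suc k) = product_space (derived_series A k) (derived_series A k)"

text \<open>Both predicates concern a subalgebra \<open>A\<close> regarded as an algebra in its own right.\<close>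

definition nilpotent :: "'a set \<Rightarrow> bool"
  where "nilpotent A \<longleftrightarrow> (\<exists>n. lower_central_series A n = {0})"

definition solvable :: "'a set \<Rightarrow> bool"
  where "solvable A \<longleftrightarrow> (\<exists>m. derived_series A m = {0})"

definition two_sided_ideal :: "'a set \<Rightarrow> bool"
  where "two_sided_ideal I \<longleftrightarrow>
    subspace I \<and> (\<forall>a\<in>I. \<forall>y. \<lbrakk>a, y\<rbrakk> \<in> I \<and> \<lbrakk>y, a\<rbrakk> \<in> I)"

text \<open>Maximality is with respect to inclusion. In finite dimension sums of nilpotent ideals are
  nilpotent, so such an ideal is unique and contains every nilpotent ideal.\<close>

definition is_nilradical :: "'a set \<Rightarrow> bool"
  where "is_nilradical N \<longleftrightarrow> two_sided_ideal N \<and> nilpotent N \<and>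
    (\<forall>I. two_sided_ideal I \<and> nilpotent I \<and> N \<subseteq> I \<longrightarrow> I = N)"

end

text \<open>Isomorphism of algebras with carriers \<open>A\<close> and \<open>B\<close>, each meant to be a subspace
  of its ambient space closed under the respective bracket.\<close>

definition algebra_isomorphic ::
  "'a set \<Rightarrow> (complex \<Rightarrow> 'a::ab_group_add \<Rightarrow> 'a) \<Rightarrow> ('a \<Rightarrow> 'a \<Rightarrow> 'a) \<Rightarrow>
   'b set \<Rightarrow> (complex \<Rightarrow> 'b::ab_group_add \<Rightarrow> 'b) \<Rightarrow> ('b \<Rightarrow> 'b \<Rightarrow> 'b) \<Rightarrow> bool"
  where "algebra_isomorphic A sA brA B sB brB \<longleftrightarrow>
    (\<exists>f. bij_betw f A B \<and>
      (\<forall>x\<in>A. \<forall>y\<in>A. f (x + y) = f x + f y) \<and>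
      (\<forall>c. \<forall>x\<in>A. f (sA c x) = sB c (f x)) \<and>
      (\<forall>x\<in>A. \<forall>y\<in>A. f (brA x y) = brB (f x) (f y)))"

text \<open>The bilinear product on $\mathbb{C}^n$ for which the product of the \<open>i\<close>-th and
  \<open>j\<close>-th standard basis vectors is \<open>t i j\<close>.\<close>

definition table_bracket ::
  "('n::finite \<Rightarrow> 'n \<Rightarrow> complex ^ 'n) \<Rightarrow> complex ^ 'n \<Rightarrow> complex ^ 'n \<Rightarrow> complex ^ 'n"
  where "table_bracket t u v = (\<Sum>i\<in>UNIV. \<Sum>j\<in>UNIV. (u $ i * v $ j) *s t i j)"

abbreviation std_basis :: "'n::finite \<Rightarrow> complex ^ 'n"
  where "std_basis i \<equiv> axis i 1"

definition lambda5_table :: "3 \<Rightarrow> 3 \<Rightarrow> complex ^ 3"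
  where "lambda5_table i j =
    (if (i, j) = (2, 1) then std_basis 3
     else if (i, j) = (1, 2) then std_basis 3
     else 0)"

definition lambda5_bracket :: "complex ^ 3 \<Rightarrow> complex ^ 3 \<Rightarrow> complex ^ 3"
  where "lambda5_bracket = table_bracket lambda5_table"

text \<open>The index \<open>4\<close> (which equals \<open>0\<close> in the type \<open>4\<close>) stands for the
  basis vector $x$.\<close>

definition L44_table :: "4 \<Rightarrow> 4 \<Rightarrow> complex ^ 4"
  where "L44_table i j =
    (if (i, j) = (1, 2) then std_basis 3
     else if (i, j) = (2, 1) then std_basis 3
     else if (i, j) = (1, 4) then std_basis 1
     else if (i, j) = (2, 4) then std_basis 2
     else if (i, j) = (3, 4) then 2 *s std_basis 3
     else if (i, j) = (4, 1) then - std_basis 1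
     else if (i, j) = (4, 2) then - std_basis 2
     else 0)"

definition L44_bracket :: "complex ^ 4 \<Rightarrow> complex ^ 4 \<Rightarrow> complex ^ 4"
  where "L44_bracket = table_bracket L44_table"

lemma table_bracket_linear:
  "Vector_Spaces.linear (*s) (*s) (\<lambda>u. table_bracket t u v)"
  "Vector_Spaces.linear (*s) (*s) (\<lambda>v. table_bracket t u v)"
  by (unfold_locales;
      simp add: table_bracket_def vec_eq_iff sum_distrib_left sum.distrib algebra_simps)+

lemma table_bracket_basis: "table_bracket t (std_basis i) (std_basis j) = t i j"
proof -
  have "(std_basis i $ k * std_basis j $ l) *s t k l
      = (if k = i then if l = j then t i j else 0 else 0)" for k l
    by (auto simp: axis_def)
  moreover have "(\<Sum>l\<in>UNIV. if k = i then if l = j then t i j else 0 else 0)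
      = (if k = i then t i j else 0)" for k
    by simp
  ultimately show ?thesis
    by (simp add: table_bracket_def)
qed

lemma leibniz_algebra_lambda5: "leibniz_algebra (*s) lambda5_bracket"
proof -
  have "leibniz_algebra_axioms (*s) lambda5_bracket"
    unfolding leibniz_algebra_axioms_def lambda5_bracket_def
    by (intro conjI allI table_bracket_linear)
      (simp add: table_bracket_def lambda5_table_def sum_3 vec_eq_iff forall_3 axis_def
        algebra_simps)
  then show ?thesis
    by (simp add: leibniz_algebra_def vec.vector_space_axioms)
qed

lemma leibniz_algebra_L44: "leibniz_algebra (*s) L44_bracket"
proof -
  have "leibniz_algebra_axioms (*s) L44_bracket"
    unfolding leibniz_algebra_axioms_def L44_bracket_def
    by (intro conjI allI table_bracket_linear)
      (simp add: table_bracket_def L44_table_def sum_4 vec_eq_iff forall_4 axis_def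
        algebra_simps)
  then show ?thesis
    by (simp add: leibniz_algebra_def vec.vector_space_axioms)
qed

end

theory Submission imports Defs begin

text \<open>
  The nilradical \<open>N\<close> has a basis \<open>e1\<close>, \<open>e2\<close>, \<open>e3\<close> whose only nonzero products are
  \<open>\<lbrakk>e1, e2\<rbrakk> = \<lbrakk>e2, e1\<rbrakk> = e3\<close>, and it is a hyperplane, so one further vector \<open>x\<close> completes the
  basis. It remains to find the products that involve \<open>x\<close>.

  Two consequences of the Leibniz identity determine them almost completely. Right
  multiplication by \<open>x\<close> is a derivation, and on \<open>N\<close> this leaves only
  \<open>e1 \<mapsto> a e1 + p e3\<close>, \<open>e2 \<mapsto> b e2 + q e3\<close>, \<open>e3 \<mapsto> (a + b) e3\<close>. And every element
  \<open>\<lbrakk>y, z\<rbrakk> + \<lbrakk>z, y\<rbrakk>\<close> is annihilated by all left multiplications, whereas inside \<open>N\<close> the elements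
  annihilated by \<open>e1\<close> and \<open>e2\<close> from the left are the multiples of \<open>e3\<close>; so left multiplication
  by \<open>x\<close> is on \<open>N\<close> the negative of right multiplication up to multiples of \<open>e3\<close>, and \<open>\<lbrakk>x, x\<rbrakk>\<close>
  is itself a multiple of \<open>e3\<close> (\<open>square_x\<close>). Now \<open>\<lbrakk>x, e3\<rbrakk>\<close>
  can be computed from \<open>e3 = \<lbrakk>e1, e2\<rbrakk>\<close> and from \<open>e3 = \<lbrakk>e2, e1\<rbrakk>\<close>, with opposite signs,
  which gives \<open>\<lbrakk>x, e3\<rbrakk> = 0\<close> and \<open>a = b\<close>. The result
  is collected in \<open>bracket_table\<close>.

  If \<open>a\<close> were \<open>0\<close>, all products would lie in the span of \<open>e3\<close>, whose products with everything
  vanish; the whole algebra would be nilpotent (\<open>nilpotent_if_weight_zero\<close>) and \<open>N\<close> would not be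
  a maximal nilpotent ideal. Hence \<open>a \<noteq> 0\<close>, and \<open>x\<close> can be rescaled so that \<open>a = 1\<close>. As \<open>e3\<close> has
  weight \<open>2\<close> and \<open>e1\<close>, \<open>e2\<close> have weight \<open>1\<close> modulo \<open>e3\<close> under right multiplication by \<open>x\<close>,
  adding multiples of \<open>e3\<close> to \<open>e1\<close>, \<open>e2\<close> and \<open>x\<close> removes the \<open>e3\<close>-terms of \<open>\<lbrakk>e1, x\<rbrakk>\<close>, \<open>\<lbrakk>e2, x\<rbrakk>\<close>
  and \<open>\<lbrakk>x, x\<rbrakk>\<close>; those of \<open>\<lbrakk>x, e1\<rbrakk>\<close> and \<open>\<lbrakk>x, e2\<rbrakk>\<close> disappear with them by the Leibniz identity
  (\<open>change_of_basis\<close>, \<open>algebra_isomorphic_L44\<close>).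
\<close>

section \<open>Brackets and bases\<close>

context leibniz_algebra
begin

lemma bracket_add_left: "\<lbrakk>u + v, y\<rbrakk> = \<lbrakk>u, y\<rbrakk> + \<lbrakk>v, y\<rbrakk>"
  and bracket_diff_left: "\<lbrakk>u - v, y\<rbrakk> = \<lbrakk>u, y\<rbrakk> - \<lbrakk>v, y\<rbrakk>"
  and bracket_scale_left: "\<lbrakk>c *\<^sub>C u, y\<rbrakk> = c *\<^sub>C \<lbrakk>u, y\<rbrakk>"
proof -
  interpret l: Vector_Spaces.linear scale scale "\<lambda>x. \<lbrakk>x, y\<rbrakk>" by (rule linear_left)
  show "\<lbrakk>u + v, y\<rbrakk> = \<lbrakk>u, y\<rbrakk> + \<lbrakk>v, y\<rbrakk>" by (rule l.add)
  show "\<lbrakk>c *\<^sub>C u, y\<rbrakk> = c *\<^sub>C \<lbrakk>u, y\<rbrakk>" by (rule l.scale)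
  show "\<lbrakk>u - v, y\<rbrakk> = \<lbrakk>u, y\<rbrakk> - \<lbrakk>v, y\<rbrakk>" by (rule l.diff)
qed

lemma bracket_add_right: "\<lbrakk>y, u + v\<rbrakk> = \<lbrakk>y, u\<rbrakk> + \<lbrakk>y, v\<rbrakk>"
  and bracket_diff_right: "\<lbrakk>y, u - v\<rbrakk> = \<lbrakk>y, u\<rbrakk> - \<lbrakk>y, v\<rbrakk>"
  and bracket_scale_right: "\<lbrakk>y, c *\<^sub>C u\<rbrakk> = c *\<^sub>C \<lbrakk>y, u\<rbrakk>"
proof -
  interpret l: Vector_Spaces.linear scale scale "\<lambda>x. \<lbrakk>y, x\<rbrakk>" by (rule linear_right)
  show "\<lbrakk>y, u + v\<rbrakk> = \<lbrakk>y, u\<rbrakk> + \<lbrakk>y, v\<rbrakk>" by (rule l.add)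
  show "\<lbrakk>y, c *\<^sub>C u\<rbrakk> = c *\<^sub>C \<lbrakk>y, u\<rbrakk>" by (rule l.scale)
  show "\<lbrakk>y, u - v\<rbrakk> = \<lbrakk>y, u\<rbrakk> - \<lbrakk>y, v\<rbrakk>" by (rule l.diff)
qed

lemma bracket_zero_left [simp]: "\<lbrakk>0, y\<rbrakk> = 0"
  using bracket_scale_left[of 0 0 y] by simp

lemma bracket_zero_right [simp]: "\<lbrakk>y, 0\<rbrakk> = 0"
  using bracket_scale_right[of y 0 0] by simp

lemmas bracket_bilinear =
  bracket_add_left bracket_add_right bracket_diff_left bracket_diff_right
  bracket_scale_left bracket_scale_right

lemma bracket_sum_sum:
  "\<lbrakk>\<Sum>i\<in>A. u i *\<^sub>C b i, \<Sum>j\<in>B. v j *\<^sub>C d j\<rbrakk> = (\<Sum>i\<in>A. \<Sum>j\<in>B. (u i * v j) *\<^sub>C \<lbrakk>b i, d j\<rbrakk>)"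
proof -
  interpret r: Vector_Spaces.linear scale scale "\<lambda>y. \<lbrakk>w, y\<rbrakk>" for w by (rule linear_right)
  interpret l: Vector_Spaces.linear scale scale "\<lambda>x. \<lbrakk>x, y\<rbrakk>" for y by (rule linear_left)
  show ?thesis
    by (simp only: l.sum) (simp add: r.sum bracket_bilinear scale_sum_right mult.commute)
qed

lemma bracket_symmetrization_right: "\<lbrakk>u, \<lbrakk>y, z\<rbrakk> + \<lbrakk>z, y\<rbrakk>\<rbrakk> = 0"
  by (simp add: bracket_add_right leibniz)

lemma bracket_square_right: "\<lbrakk>u, \<lbrakk>y, y\<rbrakk>\<rbrakk> = 0"
  by (simp add: leibniz)

text \<open>The table has to be transported along \<open>v \<mapsto> \<Sum>i. v $ i *\<^sub>C b i\<close>, which goes from the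
  coordinates to the algebra; the isomorphism is its inverse.\<close>

lemma algebra_isomorphic_table_bracket:
  fixes b :: "'n::finite \<Rightarrow> 'a"
  assumes bij: "bij (\<lambda>v :: complex ^ 'n. \<Sum>i\<in>UNIV. v $ i *\<^sub>C b i)"
    and table: "\<And>i j. \<lbrakk>b i, b j\<rbrakk> = (\<Sum>k\<in>UNIV. t i j $ k *\<^sub>C b k)"
  shows "algebra_isomorphic UNIV scale bracket (UNIV :: (complex ^ 'n) set) (*s) (table_bracket t)"
proof -
  define g where "g v = (\<Sum>i\<in>UNIV. v $ i *\<^sub>C b i)" for v :: "complex ^ 'n"
  have bij_g: "bij g" using bij unfolding g_def .
  have add: "g (u + v) = g u + g v" for u v
    by (simp add: g_def scale_left_distrib sum.distrib)
  have scale: "g (c *s v) = c *\<^sub>C g v" for c v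
    by (simp add: g_def scale_sum_right)
  have g_sum: "g (sum h S) = (\<Sum>i\<in>S. g (h i))" if "finite S" for h and S :: "'n set"
    using that by (induction S) (auto simp: add, simp add: g_def)
  have bracket: "g (table_bracket t u v) = \<lbrakk>g u, g v\<rbrakk>" for u v
  proof -
    have "g (t i j) = \<lbrakk>b i, b j\<rbrakk>" for i j by (simp add: g_def table)
    then have "g (table_bracket t u v) = (\<Sum>i\<in>UNIV. \<Sum>j\<in>UNIV. (u $ i * v $ j) *\<^sub>C \<lbrakk>b i, b j\<rbrakk>)"
      by (simp add: table_bracket_def g_sum scale)
    then show ?thesis by (simp add: g_def bracket_sum_sum)
  qed
  have g_inv: "g (inv g y) = y" for y using bij_g by (simp add: bij_is_surj surj_f_inv_f)
  have inv_eq: "inv g y = v" if "y = g v" for y v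
    using that bij_g by (simp add: bij_is_inj)
  have "inv g (y + z) = inv g y + inv g z" "inv g (c *\<^sub>C y) = c *s inv g y"
    "inv g \<lbrakk>y, z\<rbrakk> = table_bracket t (inv g y) (inv g z)" for c y z
    by (rule inv_eq; simp add: add scale bracket g_inv)+
  with bij_imp_bij_inv[OF bij_g] show ?thesis
    unfolding algebra_isomorphic_def by blast
qed

lemma ex_complementary_vector:
  assumes dim: "dim UNIV = Suc (card E)" and "independent E"
  obtains x where "x \<notin> span E" and "\<And>y. \<exists>k. y - k *\<^sub>C x \<in> span E"
proof -
  obtain B where B: "E \<subseteq> B" "independent B" and "UNIV \<subseteq> span B"
    using maximal_independent_subset_extend[OF subset_UNIV assms(2)] by metis
  then have span_B: "span B = UNIV" by blast
  have "card B = Suc (card E)"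
    using dim_eq_card[of B UNIV] B span_B dim by simp
  moreover from this have "finite B" by (simp add: card_ge_0_finite)
  ultimately have "card (B - E) = 1"
    using B by (simp add: card_Diff_subset finite_subset)
  then obtain x where x: "B - E = {x}" by (auto simp: card_1_singleton_iff)
  with B(1) have "B = insert x E" "x \<notin> E" by auto
  moreover from this B have "x \<notin> span E" by (simp add: independent_insert)
  ultimately show thesis using that span_B span_breakdown_eq[of _ x E] by blast
qed

end

section \<open>Extensions of the algebra $\lambda_5$ by one dimension\<close>

text \<open>The complement \<open>x\<close> and the basis of \<open>N\<close> are parameters, so that a change of basis is a
  second interpretation with the same \<open>N\<close>.\<close>

locale lambda5_extension = leibniz_algebra +
  fixes N :: "'a set" and e1 e2 e3 x :: 'a
  assumes ideal: "two_sided_ideal N"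
    and mem_N: "\<And>y. y \<in> N \<longleftrightarrow> (\<exists>p q r. y = p *\<^sub>C e1 + q *\<^sub>C e2 + r *\<^sub>C e3)"
    and coordinates_zero:
      "\<And>p q r. p *\<^sub>C e1 + q *\<^sub>C e2 + r *\<^sub>C e3 = 0 \<Longrightarrow> p = 0 \<and> q = 0 \<and> r = 0"
    and table_N:
      "\<lbrakk>e1, e1\<rbrakk> = 0" "\<lbrakk>e1, e2\<rbrakk> = e3" "\<lbrakk>e1, e3\<rbrakk> = 0"
      "\<lbrakk>e2, e1\<rbrakk> = e3" "\<lbrakk>e2, e2\<rbrakk> = 0" "\<lbrakk>e2, e3\<rbrakk> = 0"
      "\<lbrakk>e3, e1\<rbrakk> = 0" "\<lbrakk>e3, e2\<rbrakk> = 0" "\<lbrakk>e3, e3\<rbrakk> = 0"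
    and x_notin: "x \<notin> N"
    and complement: "\<And>y. \<exists>k. y - k *\<^sub>C x \<in> N"
begin

lemma subspace_N: "subspace N"
  using ideal by (simp add: two_sided_ideal_def)

lemma bracket_in_N: "n \<in> N \<Longrightarrow> \<lbrakk>n, y\<rbrakk> \<in> N" "n \<in> N \<Longrightarrow> \<lbrakk>y, n\<rbrakk> \<in> N"
  using ideal by (auto simp: two_sided_ideal_def)

lemma e_in_N: "e1 \<in> N" "e2 \<in> N" "e3 \<in> N"
proof -
  have "e1 = 1 *\<^sub>C e1 + 0 *\<^sub>C e2 + 0 *\<^sub>C e3" "e2 = 0 *\<^sub>C e1 + 1 *\<^sub>C e2 + 0 *\<^sub>C e3"
    "e3 = 0 *\<^sub>C e1 + 0 *\<^sub>C e2 + 1 *\<^sub>C e3" by simp_all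
  then show "e1 \<in> N" "e2 \<in> N" "e3 \<in> N" unfolding mem_N by blast+
qed

lemma e3_nonzero [simp]: "e3 \<noteq> 0"
  using coordinates_zero[of 0 0 1] by auto

lemma scale_e3_cancel: "r *\<^sub>C e3 = s *\<^sub>C e3 \<longleftrightarrow> r = s"
  by simp

lemma scale_x_in_N: "k *\<^sub>C x \<in> N \<longleftrightarrow> k = 0"
proof
  assume "k *\<^sub>C x \<in> N"
  then have "(inverse k * k) *\<^sub>C x \<in> N"
    using subspace_scale[OF subspace_N, of "k *\<^sub>C x" "inverse k"] by simp
  with x_notin show "k = 0" by (cases "k = 0") auto
qed (simp add: subspace_0[OF subspace_N])

lemma ex_coordinates: "\<exists>k p q r. y = k *\<^sub>C x + p *\<^sub>C e1 + q *\<^sub>C e2 + r *\<^sub>C e3"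
proof -
  obtain k where "y - k *\<^sub>C x \<in> N" using complement by blast
  then obtain p q r where "y - k *\<^sub>C x = p *\<^sub>C e1 + q *\<^sub>C e2 + r *\<^sub>C e3" by (auto simp: mem_N)
  then have "y = k *\<^sub>C x + p *\<^sub>C e1 + q *\<^sub>C e2 + r *\<^sub>C e3" by (simp add: algebra_simps)
  then show ?thesis by blast
qed

text \<open>The product on \<open>N\<close> modulo \<open>e3\<close> is a nondegenerate pairing: \<open>e1\<close> detects the
  \<open>e2\<close>-coordinate and \<open>e2\<close> the \<open>e1\<close>-coordinate.\<close>

lemma right_annihilator_N:
  assumes "z \<in> N" "\<lbrakk>e1, z\<rbrakk> = 0" "\<lbrakk>e2, z\<rbrakk> = 0"
  obtains s where "z = s *\<^sub>C e3"
proof -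
  obtain p q r where z: "z = p *\<^sub>C e1 + q *\<^sub>C e2 + r *\<^sub>C e3" using assms(1) by (auto simp: mem_N)
  have "q = 0" "p = 0"
    using assms(2,3) scale_e3_cancel[of _ 0] by (auto simp: z bracket_bilinear table_N)
  with z have "z = r *\<^sub>C e3" by simp
  then show thesis by (rule that)
qed

text \<open>This makes left multiplication by \<open>x\<close> known on \<open>N\<close> up to one scalar per argument: the
  symmetrization \<open>\<lbrakk>n, x\<rbrakk> + \<lbrakk>x, n\<rbrakk>\<close> is annihilated by every left multiplication.\<close>

lemma left_action_from_right:
  assumes "n \<in> N"
  obtains s where "\<lbrakk>x, n\<rbrakk> = s *\<^sub>C e3 - \<lbrakk>n, x\<rbrakk>"
proof -
  have "\<lbrakk>n, x\<rbrakk> + \<lbrakk>x, n\<rbrakk> \<in> N"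
    using assms by (intro subspace_add[OF subspace_N] bracket_in_N)
  then obtain s where "\<lbrakk>n, x\<rbrakk> + \<lbrakk>x, n\<rbrakk> = s *\<^sub>C e3"
    by (rule right_annihilator_N[OF _ bracket_symmetrization_right bracket_symmetrization_right])
  then have "\<lbrakk>x, n\<rbrakk> = s *\<^sub>C e3 - \<lbrakk>n, x\<rbrakk>" by (simp add: algebra_simps)
  then show thesis by (rule that)
qed

text \<open>Modulo \<open>N\<close> the algebra is one-dimensional. If \<open>\<lbrakk>x, x\<rbrakk> \<equiv> k x\<close> there, multiplying by
  \<open>x\<close> from the left gives \<open>0 \<equiv> k\<^sup>2 x\<close>, because squares are annihilated from the left. So
  \<open>\<lbrakk>x, x\<rbrakk>\<close> lies in \<open>N\<close>, and being a square it is a multiple of \<open>e3\<close>.\<close>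

lemma square_x: obtains s where "\<lbrakk>x, x\<rbrakk> = s *\<^sub>C e3"
proof -
  obtain k where k: "\<lbrakk>x, x\<rbrakk> - k *\<^sub>C x \<in> N" using complement by blast
  \<comment> \<open>The multiple of \<open>\<lbrakk>x, x\<rbrakk>\<close> cancels, and \<open>- k\<^sup>2 x\<close> remains.\<close>
  have "\<lbrakk>x, \<lbrakk>x, x\<rbrakk> - k *\<^sub>C x\<rbrakk> + k *\<^sub>C (\<lbrakk>x, x\<rbrakk> - k *\<^sub>C x) \<in> N"
    using k by (intro subspace_add[OF subspace_N] subspace_scale[OF subspace_N] bracket_in_N)
  moreover have "\<lbrakk>x, \<lbrakk>x, x\<rbrakk> - k *\<^sub>C x\<rbrakk> = - (k *\<^sub>C \<lbrakk>x, x\<rbrakk>)"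
    using bracket_add_right[of x "\<lbrakk>x, x\<rbrakk> - k *\<^sub>C x" "k *\<^sub>C x"]
    by (simp add: bracket_square_right bracket_scale_right eq_neg_iff_add_eq_0)
  ultimately have "- ((k * k) *\<^sub>C x) \<in> N" by (simp add: scale_right_diff_distrib)
  then have "(k * k) *\<^sub>C x \<in> N" using subspace_neg[OF subspace_N] by fastforce
  then have "k = 0" by (simp add: scale_x_in_N)
  with k have "\<lbrakk>x, x\<rbrakk> \<in> N" by simp
  then obtain s where "\<lbrakk>x, x\<rbrakk> = s *\<^sub>C e3"
    by (rule right_annihilator_N[OF _ bracket_square_right bracket_square_right])
  then show thesis by (rule that)
qed

text \<open>The derivation rule applied to \<open>\<lbrakk>e1, e1\<rbrakk> = 0\<close> and \<open>\<lbrakk>e2, e2\<rbrakk> = 0\<close> makes right multiplication by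
  \<open>x\<close> diagonal modulo \<open>e3\<close>; the symmetry of the product on \<open>N\<close> then forces both eigenvalues
  to agree.\<close>

lemma bracket_table:
  obtains a p q p' q' s where
    "\<lbrakk>e1, x\<rbrakk> = a *\<^sub>C e1 + p *\<^sub>C e3" "\<lbrakk>e2, x\<rbrakk> = a *\<^sub>C e2 + q *\<^sub>C e3" "\<lbrakk>e3, x\<rbrakk> = (2 * a) *\<^sub>C e3"
    "\<lbrakk>x, e1\<rbrakk> = (- a) *\<^sub>C e1 + p' *\<^sub>C e3" "\<lbrakk>x, e2\<rbrakk> = (- a) *\<^sub>C e2 + q' *\<^sub>C e3"
    "\<lbrakk>x, e3\<rbrakk> = 0" "\<lbrakk>x, x\<rbrakk> = s *\<^sub>C e3"
proof -
  obtain a a2 p where "\<lbrakk>e1, x\<rbrakk> = a *\<^sub>C e1 + a2 *\<^sub>C e2 + p *\<^sub>C e3"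
    using bracket_in_N(1)[OF e_in_N(1)] unfolding mem_N by blast
  moreover from this have "a2 *\<^sub>C e3 = (- a2) *\<^sub>C e3"
    using leibniz[of e1 e1 x] by (simp add: bracket_bilinear table_N)
  then have "a2 = 0" by (simp only: scale_e3_cancel) simp
  ultimately have e1x: "\<lbrakk>e1, x\<rbrakk> = a *\<^sub>C e1 + p *\<^sub>C e3" by simp
  obtain b1 b q where "\<lbrakk>e2, x\<rbrakk> = b1 *\<^sub>C e1 + b *\<^sub>C e2 + q *\<^sub>C e3"
    using bracket_in_N(1)[OF e_in_N(2)] unfolding mem_N by blast
  moreover from this have "b1 *\<^sub>C e3 = (- b1) *\<^sub>C e3"
    using leibniz[of e2 e2 x] by (simp add: bracket_bilinear table_N)
  then have "b1 = 0" by (simp only: scale_e3_cancel) simp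
  ultimately have e2x: "\<lbrakk>e2, x\<rbrakk> = b *\<^sub>C e2 + q *\<^sub>C e3" by simp
  obtain s1 where "\<lbrakk>x, e1\<rbrakk> = s1 *\<^sub>C e3 - \<lbrakk>e1, x\<rbrakk>" using e_in_N(1) by (rule left_action_from_right)
  then have xe1: "\<lbrakk>x, e1\<rbrakk> = (- a) *\<^sub>C e1 + (s1 - p) *\<^sub>C e3"
    by (simp add: e1x algebra_simps)
  obtain s2 where "\<lbrakk>x, e2\<rbrakk> = s2 *\<^sub>C e3 - \<lbrakk>e2, x\<rbrakk>" using e_in_N(2) by (rule left_action_from_right)
  then have xe2: "\<lbrakk>x, e2\<rbrakk> = (- b) *\<^sub>C e2 + (s2 - q) *\<^sub>C e3"
    by (simp add: e2x algebra_simps)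
  \<comment> \<open>Since \<open>e3\<close> is both \<open>\<lbrakk>e1, e2\<rbrakk>\<close> and \<open>\<lbrakk>e2, e1\<rbrakk>\<close>, the Leibniz identity evaluates
    \<open>\<lbrakk>x, e3\<rbrakk>\<close> in two ways that differ by a sign.\<close>
  have xe3: "\<lbrakk>x, e3\<rbrakk> = (b - a) *\<^sub>C e3"
    using leibniz[of x e1 e2] by (simp add: xe1 xe2 bracket_bilinear table_N algebra_simps)
  have xe3': "\<lbrakk>x, e3\<rbrakk> = (a - b) *\<^sub>C e3"
    using leibniz[of x e2 e1] by (simp add: xe1 xe2 bracket_bilinear table_N algebra_simps)
  have "b - a = a - b"
    using xe3' unfolding xe3 scale_e3_cancel .
  then have ab: "b = a" by (simp add: algebra_simps flip: mult_2)
  have "\<lbrakk>e3, x\<rbrakk> = a *\<^sub>C e3 + a *\<^sub>C e3"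
    using leibniz[of e1 e2 x] by (simp add: e1x e2x ab bracket_bilinear table_N algebra_simps)
  then have e3x: "\<lbrakk>e3, x\<rbrakk> = (2 * a) *\<^sub>C e3" by (simp flip: scale_left_distrib)
  obtain s where xx: "\<lbrakk>x, x\<rbrakk> = s *\<^sub>C e3" by (rule square_x)
  have "\<lbrakk>x, e3\<rbrakk> = 0" using xe3 ab by simp
  then show thesis
    by (rule that[OF e1x e2x[unfolded ab] e3x xe1 xe2[unfolded ab] _ xx])
qed

text \<open>The algebra has class two: every product is a multiple of \<open>e3\<close>, which is now central in the
  whole algebra and not only in \<open>N\<close>.\<close>

lemma nilpotent_if_weight_zero:
  assumes "\<lbrakk>e1, x\<rbrakk> = p *\<^sub>C e3" "\<lbrakk>e2, x\<rbrakk> = q *\<^sub>C e3" "\<lbrakk>e3, x\<rbrakk> = 0"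
    "\<lbrakk>x, e1\<rbrakk> = p' *\<^sub>C e3" "\<lbrakk>x, e2\<rbrakk> = q' *\<^sub>C e3" "\<lbrakk>x, e3\<rbrakk> = 0" "\<lbrakk>x, x\<rbrakk> = s *\<^sub>C e3"
  shows "nilpotent UNIV"
proof -
  have "\<lbrakk>u, v\<rbrakk> \<in> span {e3}" for u v
  proof -
    obtain k l m n where u: "u = k *\<^sub>C x + l *\<^sub>C e1 + m *\<^sub>C e2 + n *\<^sub>C e3" using ex_coordinates by blast
    obtain k' l' m' n' where v: "v = k' *\<^sub>C x + l' *\<^sub>C e1 + m' *\<^sub>C e2 + n' *\<^sub>C e3"
      using ex_coordinates by blast
    show ?thesis
      unfolding u v bracket_bilinear assms table_N
      by (intro span_add span_scale span_zero span_base[OF insertI1])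
  qed
  then have lcs1: "lower_central_series UNIV 1 \<subseteq> span {e3}"
    by (simp add: product_space_def) (rule span_minimal; auto)
  have e3_left: "\<lbrakk>e3, v\<rbrakk> = 0" for v
  proof -
    obtain k l m n where "v = k *\<^sub>C x + l *\<^sub>C e1 + m *\<^sub>C e2 + n *\<^sub>C e3" using ex_coordinates by blast
    then show ?thesis by (simp add: bracket_bilinear assms table_N)
  qed
  have "\<lbrakk>u, v\<rbrakk> = 0" if "u \<in> lower_central_series UNIV 1" for u v
  proof -
    from that lcs1 obtain k where "u = k *\<^sub>C e3" unfolding span_singleton by blast
    then show ?thesis by (simp add: bracket_scale_left e3_left)
  qed
  then have "product_space (lower_central_series UNIV 1) UNIV \<subseteq> span {0}"
    unfolding product_space_def by (intro span_mono) blast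
  then have "lower_central_series UNIV 2 = {0}"
    by (auto simp: numeral_2_eq_2 product_space_def span_zero)
  then show ?thesis unfolding nilpotent_def by blast
qed

lemma not_nilpotent:
  assumes "is_nilradical N"
  shows "\<not> nilpotent UNIV"
proof
  assume "nilpotent UNIV"
  moreover have "two_sided_ideal UNIV" by (simp add: two_sided_ideal_def)
  ultimately have "UNIV = N" using assms by (auto simp: is_nilradical_def)
  with x_notin show False by blast
qed

lemma algebra_isomorphic_L44_if_table:
  assumes "\<lbrakk>e1, x\<rbrakk> = e1" "\<lbrakk>e2, x\<rbrakk> = e2" "\<lbrakk>e3, x\<rbrakk> = 2 *\<^sub>C e3"
    "\<lbrakk>x, e1\<rbrakk> = - e1" "\<lbrakk>x, e2\<rbrakk> = - e2" "\<lbrakk>x, e3\<rbrakk> = 0" "\<lbrakk>x, x\<rbrakk> = 0"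
  shows "algebra_isomorphic UNIV scale bracket (UNIV :: (complex ^ 4) set) (*s) L44_bracket"
proof -
  define b :: "4 \<Rightarrow> 'a" where
    "b i = (if i = 1 then e1 else if i = 2 then e2 else if i = 3 then e3 else x)" for i
  define g where "g v = (\<Sum>i\<in>UNIV. v $ i *\<^sub>C b i)" for v :: "complex ^ 4"
  have g: "g v = v $ 4 *\<^sub>C x + v $ 1 *\<^sub>C e1 + v $ 2 *\<^sub>C e2 + v $ 3 *\<^sub>C e3" for v
    by (simp add: g_def b_def sum_4 algebra_simps)
  have "surj g"
  proof (unfold surj_def, intro allI)
    fix y
    obtain k p q r where "y = k *\<^sub>C x + p *\<^sub>C e1 + q *\<^sub>C e2 + r *\<^sub>C e3"
      using ex_coordinates by blast
    then have "y = g (\<chi> i. if i = 1 then p else if i = 2 then q else if i = 3 then r else k)"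
      by (simp add: g)
    then show "\<exists>v. y = g v" by blast
  qed
  moreover have "inj g"
  proof (rule injI)
    fix u v assume "g u = g v"
    define d where "d = u - v"
    have zero: "d $ 4 *\<^sub>C x + (d $ 1 *\<^sub>C e1 + d $ 2 *\<^sub>C e2 + d $ 3 *\<^sub>C e3) = 0"
      using \<open>g u = g v\<close> by (simp add: g d_def algebra_simps)
    have "d $ 1 *\<^sub>C e1 + d $ 2 *\<^sub>C e2 + d $ 3 *\<^sub>C e3 \<in> N" unfolding mem_N by blast
    then have "- (d $ 1 *\<^sub>C e1 + d $ 2 *\<^sub>C e2 + d $ 3 *\<^sub>C e3) \<in> N" by (rule subspace_neg[OF subspace_N])
    then have "d $ 4 *\<^sub>C x \<in> N" using zero by (simp only: eq_neg_iff_add_eq_0[symmetric])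
    then have d4: "d $ 4 = 0" by (simp add: scale_x_in_N)
    moreover have "d $ 1 = 0 \<and> d $ 2 = 0 \<and> d $ 3 = 0"
      using zero d4 by (intro coordinates_zero) simp
    ultimately have "d = 0" by (simp add: vec_eq_iff forall_4)
    then show "u = v" by (simp add: d_def)
  qed
  ultimately have "bij g" by (simp add: bij_def)
  moreover have "\<lbrakk>b i, b j\<rbrakk> = g (L44_table i j)" for i j
    using exhaust_4[of i] exhaust_4[of j]
    by (auto simp: b_def g L44_table_def axis_def table_N assms)
  ultimately show ?thesis
    unfolding L44_bracket_def g_def by (rule algebra_isomorphic_table_bracket)
qed

text \<open>Multiples of \<open>e3\<close> do not affect products within \<open>N\<close>, because \<open>e3\<close> is central there.\<close>

lemma change_of_basis:
  assumes "c \<noteq> 0"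
  shows "lambda5_extension scale bracket N (e1 + p *\<^sub>C e3) (e2 + q *\<^sub>C e3) e3 (c *\<^sub>C x + r *\<^sub>C e3)"
proof unfold_locales
  have combination: "u *\<^sub>C (e1 + p *\<^sub>C e3) + v *\<^sub>C (e2 + q *\<^sub>C e3) + w *\<^sub>C e3
    = u *\<^sub>C e1 + v *\<^sub>C e2 + (w + u * p + v * q) *\<^sub>C e3" for u v w
    by (simp add: algebra_simps)
  show "y \<in> N \<longleftrightarrow> (\<exists>u v w. y = u *\<^sub>C (e1 + p *\<^sub>C e3) + v *\<^sub>C (e2 + q *\<^sub>C e3) + w *\<^sub>C e3)" for y
  proof
    assume "y \<in> N"
    then obtain u v w where "y = u *\<^sub>C e1 + v *\<^sub>C e2 + w *\<^sub>C e3" by (auto simp: mem_N)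
    then have "y = u *\<^sub>C (e1 + p *\<^sub>C e3) + v *\<^sub>C (e2 + q *\<^sub>C e3) + (w - u * p - v * q) *\<^sub>C e3"
      unfolding combination by simp
    then show "\<exists>u v w. y = u *\<^sub>C (e1 + p *\<^sub>C e3) + v *\<^sub>C (e2 + q *\<^sub>C e3) + w *\<^sub>C e3" by blast
  qed (auto simp: combination mem_N)
  show "u = 0 \<and> v = 0 \<and> w = 0"
    if "u *\<^sub>C (e1 + p *\<^sub>C e3) + v *\<^sub>C (e2 + q *\<^sub>C e3) + w *\<^sub>C e3 = 0" for u v w
    using coordinates_zero[OF that[unfolded combination]] by auto
  have re3: "t *\<^sub>C e3 \<in> N" for t by (intro subspace_scale[OF subspace_N] e_in_N)
  show "c *\<^sub>C x + r *\<^sub>C e3 \<notin> N"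
  proof
    assume "c *\<^sub>C x + r *\<^sub>C e3 \<in> N"
    from subspace_diff[OF subspace_N this re3[of r]] have "c *\<^sub>C x \<in> N" by simp
    with assms show False by (simp add: scale_x_in_N)
  qed
  show "\<exists>k. y - k *\<^sub>C (c *\<^sub>C x + r *\<^sub>C e3) \<in> N" for y
  proof -
    obtain k where k: "y - k *\<^sub>C x \<in> N" using complement by blast
    have "y - (k / c) *\<^sub>C (c *\<^sub>C x + r *\<^sub>C e3) = (y - k *\<^sub>C x) - (k / c * r) *\<^sub>C e3"
      using assms by (simp add: scale_right_distrib)
    then show ?thesis using subspace_diff[OF subspace_N k re3] by metis
  qed
qed (simp_all add: ideal bracket_bilinear table_N)

lemma algebra_isomorphic_L44:
  assumes "is_nilradical N"
  shows "algebra_isomorphic UNIV scale bracket (UNIV :: (complex ^ 4) set) (*s) L44_bracket"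
proof -
  obtain a p q p' q' s where table:
    "\<lbrakk>e1, x\<rbrakk> = a *\<^sub>C e1 + p *\<^sub>C e3" "\<lbrakk>e2, x\<rbrakk> = a *\<^sub>C e2 + q *\<^sub>C e3" "\<lbrakk>e3, x\<rbrakk> = (2 * a) *\<^sub>C e3"
    "\<lbrakk>x, e1\<rbrakk> = (- a) *\<^sub>C e1 + p' *\<^sub>C e3" "\<lbrakk>x, e2\<rbrakk> = (- a) *\<^sub>C e2 + q' *\<^sub>C e3"
    "\<lbrakk>x, e3\<rbrakk> = 0" "\<lbrakk>x, x\<rbrakk> = s *\<^sub>C e3"
    by (rule bracket_table)
  have a: "a \<noteq> 0"
  proof
    assume "a = 0"
    then have "nilpotent UNIV"
      using nilpotent_if_weight_zero[of p q p' q' s] table by simp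
    with not_nilpotent[OF assms] show False by simp
  qed
  \<comment> \<open>One correction of \<open>e1\<close> has to serve both \<open>\<lbrakk>e1, x\<rbrakk>\<close> and \<open>\<lbrakk>x, e1\<rbrakk>\<close>, so their \<open>e3\<close>-terms must
    match; likewise for \<open>e2\<close>.\<close>
  have "(a * p') *\<^sub>C e3 = (2 * a * p' - a * p) *\<^sub>C e3"
    using leibniz[of x e1 x] by (simp add: table bracket_bilinear table_N algebra_simps)
  with a have p': "p' = p" by (simp add: scale_e3_cancel)
  have "(a * q') *\<^sub>C e3 = (2 * a * q' - a * q) *\<^sub>C e3"
    using leibniz[of x e2 x] by (simp add: table bracket_bilinear table_N algebra_simps)
  with a have q': "q' = q" by (simp add: scale_e3_cancel)
  define c where "c = inverse a"
  have c: "c \<noteq> 0" "c * a = 1" "a * c = 1" using a by (simp_all add: c_def)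
  \<comment> \<open>With \<open>\<lbrakk>e3, c x\<rbrakk> = 2 e3\<close> and \<open>\<lbrakk>x, e3\<rbrakk> = 0\<close>, the square of \<open>c x + r e3\<close> is
    \<open>(c\<^sup>2 s + 2 r) e3\<close>, and \<open>e1 + t e3\<close> is an eigenvector for \<open>t = - c p\<close>.\<close>
  define r where "r = - (c * c * s) / 2"
  interpret changed: lambda5_extension scale bracket N
    "e1 + (- (c * p)) *\<^sub>C e3" "e2 + (- (c * q)) *\<^sub>C e3" e3 "c *\<^sub>C x + r *\<^sub>C e3"
    using c(1) by (rule change_of_basis)
  show ?thesis
    by (rule changed.algebra_isomorphic_L44_if_table)
      (simp_all add: bracket_bilinear table table_N p' q' r_def c algebra_simps flip: scale_left_distrib)
qed

end

section \<open>Classification\<close>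

text \<open>The isomorphism is only known to be injective on \<open>N\<close>; since \<open>N\<close> is an ideal, the products of
  the basis vectors stay in \<open>N\<close> and can be identified by their images.\<close>

lemma (in leibniz_algebra) lambda5_isomorphism_basis:
  assumes ideal: "two_sided_ideal N"
    and iso: "algebra_isomorphic N scale bracket (UNIV :: (complex ^ 3) set) (*s) lambda5_bracket"
  obtains e1 e2 e3 where
    "\<forall>y. y \<in> N \<longleftrightarrow> (\<exists>p q r. y = p *\<^sub>C e1 + q *\<^sub>C e2 + r *\<^sub>C e3)"
    "\<forall>p q r. p *\<^sub>C e1 + q *\<^sub>C e2 + r *\<^sub>C e3 = 0 \<longrightarrow> p = 0 \<and> q = 0 \<and> r = 0"
    "\<lbrakk>e1, e1\<rbrakk> = 0" "\<lbrakk>e1, e2\<rbrakk> = e3" "\<lbrakk>e1, e3\<rbrakk> = 0"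
    "\<lbrakk>e2, e1\<rbrakk> = e3" "\<lbrakk>e2, e2\<rbrakk> = 0" "\<lbrakk>e2, e3\<rbrakk> = 0"
    "\<lbrakk>e3, e1\<rbrakk> = 0" "\<lbrakk>e3, e2\<rbrakk> = 0" "\<lbrakk>e3, e3\<rbrakk> = 0"
proof -
  obtain f :: "'a \<Rightarrow> complex ^ 3" where bij: "bij_betw f N UNIV"
    and f_add: "\<And>y z. y \<in> N \<Longrightarrow> z \<in> N \<Longrightarrow> f (y + z) = f y + f z"
    and f_scale: "\<And>c y. y \<in> N \<Longrightarrow> f (c *\<^sub>C y) = c *s f y"
    and f_bracket: "\<And>y z. y \<in> N \<Longrightarrow> z \<in> N \<Longrightarrow> f \<lbrakk>y, z\<rbrakk> = lambda5_bracket (f y) (f z)"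
    using iso unfolding algebra_isomorphic_def by auto
  have sub: "subspace N" using ideal by (simp add: two_sided_ideal_def)
  have f_eq: "y = z" if "f y = f z" "y \<in> N" "z \<in> N" for y z
    using that bij by (auto simp: bij_betw_def inj_on_def)
  define e where "e i = inv_into N f (std_basis i)" for i
  have e_in: "e i \<in> N" and f_e: "f (e i) = std_basis i" for i
    using bij by (auto simp: e_def bij_betw_def inv_into_into f_inv_into_f)
  have closed: "\<lbrakk>e i, e j\<rbrakk> \<in> N" for i j
    using ideal e_in by (simp add: two_sided_ideal_def)
  have f_0: "f 0 = 0" using f_scale[of 0 0] subspace_0[OF sub] by simp
  have table: "\<lbrakk>e i, e j\<rbrakk> = z" if "lambda5_table i j = f z" "z \<in> N" for i j z
    using that by (intro f_eq closed)
      (simp_all add: f_bracket e_in f_e lambda5_bracket_def table_bracket_basis)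
  have comb_in: "p *\<^sub>C e 1 + q *\<^sub>C e 2 + r *\<^sub>C e 3 \<in> N" for p q r
    by (intro subspace_add[OF sub] subspace_scale[OF sub] e_in)
  have f_comb: "f (p *\<^sub>C e 1 + q *\<^sub>C e 2 + r *\<^sub>C e 3)
    = p *s std_basis 1 + q *s std_basis 2 + r *s std_basis 3" for p q r
    by (simp add: f_add f_scale f_e e_in subspace_add[OF sub] subspace_scale[OF sub])
  show thesis
  proof (rule that[of "e 1" "e 2" "e 3"])
    show "\<forall>y. y \<in> N \<longleftrightarrow> (\<exists>p q r. y = p *\<^sub>C e 1 + q *\<^sub>C e 2 + r *\<^sub>C e 3)"
    proof (intro allI iffI)
      fix y
      assume "y \<in> N"
      then have "y = f y $ 1 *\<^sub>C e 1 + f y $ 2 *\<^sub>C e 2 + f y $ 3 *\<^sub>C e 3"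
        by (intro f_eq comb_in) (simp_all only: f_comb, simp add: vec_eq_iff forall_3 axis_def)
      then show "\<exists>p q r. y = p *\<^sub>C e 1 + q *\<^sub>C e 2 + r *\<^sub>C e 3" by blast
    qed (auto simp: comb_in)
    show "\<forall>p q r. p *\<^sub>C e 1 + q *\<^sub>C e 2 + r *\<^sub>C e 3 = 0 \<longrightarrow> p = 0 \<and> q = 0 \<and> r = 0"
    proof (intro allI impI)
      fix p q r assume "p *\<^sub>C e 1 + q *\<^sub>C e 2 + r *\<^sub>C e 3 = 0"
      with f_comb[of p q r] show "p = 0 \<and> q = 0 \<and> r = 0"
        by (simp add: f_0 vec_eq_iff forall_3 axis_def)
    qed
  qed (rule table; simp add: lambda5_table_def f_0 f_e e_in subspace_0[OF sub])+
qed

theorem proposition3p13: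
  fixes scale :: "complex \<Rightarrow> 'a::ab_group_add \<Rightarrow> 'a"
    and bracket :: "'a \<Rightarrow> 'a \<Rightarrow> 'a"
    and N :: "'a set"
  assumes "leibniz_algebra scale bracket"
    and "vector_space.dim scale UNIV = 4"
    and "leibniz_algebra.solvable scale bracket UNIV"
    and "leibniz_algebra.is_nilradical scale bracket N"
    and "algebra_isomorphic N scale bracket (UNIV :: (complex ^ 3) set) (*s) lambda5_bracket"
  shows "algebra_isomorphic UNIV scale bracket (UNIV :: (complex ^ 4) set) (*s) L44_bracket"
proof -
  interpret leibniz_algebra scale bracket by fact
  have ideal: "two_sided_ideal N" using assms(4) by (simp add: is_nilradical_def)
  obtain e1 e2 e3 where
    mem: "\<forall>y. y \<in> N \<longleftrightarrow> (\<exists>p q r. y = scale p e1 + scale q e2 + scale r e3)"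
    and zero: "\<forall>p q r. scale p e1 + scale q e2 + scale r e3 = 0 \<longrightarrow> p = 0 \<and> q = 0 \<and> r = 0"
    and table: "bracket e1 e1 = 0" "bracket e1 e2 = e3" "bracket e1 e3 = 0"
      "bracket e2 e1 = e3" "bracket e2 e2 = 0" "bracket e2 e3 = 0"
      "bracket e3 e1 = 0" "bracket e3 e2 = 0" "bracket e3 e3 = 0"
    by (rule lambda5_isomorphism_basis[OF ideal assms(5)])
  have indep: "e1 \<notin> span {e2, e3}" "e2 \<notin> span {e3}" "e3 \<noteq> 0"
  proof -
    show "e1 \<notin> span {e2, e3}"
    proof
      assume "e1 \<in> span {e2, e3}"
      then obtain q r where "e1 - scale q e2 - scale r e3 = 0"
        by (auto simp: span_breakdown_eq)
      then show False using zero[rule_format, of 1 "- q" "- r"] by simp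
    qed
    show "e2 \<notin> span {e3}"
    proof
      assume "e2 \<in> span {e3}"
      then obtain r where "e2 - scale r e3 = 0" by (auto simp: span_breakdown_eq)
      then show False using zero[rule_format, of 0 1 "- r"] by simp
    qed
    show "e3 \<noteq> 0" using zero[rule_format, of 0 0 1] by auto
  qed
  then have "e1 \<notin> {e2, e3}" "e2 \<notin> {e3}" using span_base by blast+
  with indep have "independent {e1, e2, e3}" "card {e1, e2, e3} = 3"
    by (auto simp: independent_insert)
  moreover have "span {e1, e2, e3} = N"
  proof (rule set_eqI)
    fix y
    have "y - scale p e1 - scale q e2 - scale r e3 = 0
      \<longleftrightarrow> y = scale p e1 + scale q e2 + scale r e3" for p q r
      by (auto simp: algebra_simps)
    then show "y \<in> span {e1, e2, e3} \<longleftrightarrow> y \<in> N" by (simp add: mem span_breakdown_eq)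
  qed
  ultimately obtain x where "x \<notin> N" "\<And>y. \<exists>k. y - scale k x \<in> N"
    using ex_complementary_vector[of "{e1, e2, e3}"] assms(2) by auto
  then interpret lambda5_extension scale bracket N e1 e2 e3 x
    by unfold_locales (simp_all add: ideal mem zero table)
  show ?thesis using assms(4) by (rule algebra_isomorphic_L44)
qed

end
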